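(* Let $d\ge 1$, let $\mathbf f$ be a $d\times d$ matrix-valued trigonometric polynomial with $\mathbf f(\theta)\ge 0$ for all $\theta$, and suppose that there exist unique $\theta_0\in[0,2\pi)$ and $\bar\jmath\in\{1,\dots,d\}$ such that $\lambda_{\bar\jmath}(\mathbf f(\theta_0))=0$ while $\lambda_j(\mathbf f(\theta))>0$ for every $(\theta,j)\ne(\theta_0,\bar\jmath)$, $\theta\in[0,2\pi)$. Let $q_{\bar\jmath}(\theta_0)$ be the eigenvector of $\mathbf f(\theta_0)$ with $\mathbf f(\theta_0)q_{\bar\jmath}(\theta_0)=0$. Let $\mathbf p$ be a $d\times d$ matrix-valued trigonometric polynomial such that $\mathbf p(\theta)^H\mathbf p(\theta)+\mathbf p(\theta+\pi)^H\mathbf p(\theta+\pi)>0$ for all $\theta\in[0,2\pi)$, and set $$\mathbf s(\theta)=\mathbf p(\theta)\left(\mathbf p(\theta)^H\mathbf p(\theta)+\mathbf p(\theta+\pi)^H\mathbf p(\theta+\pi)\right)^{-1}\mathbf p(\theta)^H .$$ Assume that 1. $\mathbf p(\theta_0)q_{\bar\jmath}(\theta_0)=\lambda^{(1)}_{\bar\jmath}q_{\bar\jmath}(\theta_0)$ for some $\lambda^{(1)}_{\bar\jmath}\ne0$; 2. $\mathbf p(\theta_0+\pi)q_{\bar\jmath}(\theta_0)=0$; 3. $\mathbf p(\theta_0)^Hq_{\bar\jmath}(\theta_0)=\lambda^{(2)}_{\bar\jmath}q_{\bar\jmath}(\theta_0)$ for some $\lambda^{(2)}_{\bar\jmath}\ne0$.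 Then $\mathbf s(\theta_0)q_{\bar\jmath}(\theta_0)=q_{\bar\jmath}(\theta_0)$.
   Context: A $d\times d$ matrix-valued trigonometric polynomial is a finite sum $\sum_j \hat{\mathbf f}_j e^{\iota j\theta}$ with $\hat{\mathbf f}_j\in\mathbb C^{d\times d}$, $\iota^2=-1$. $X^H$ is the conjugate transpose; $X\ge0$ (resp. $X>0$) means $X$ is Hermitian nonnegative (resp. positive) definite. $\lambda_1(\mathbf f(\theta)),\dots,\lambda_d(\mathbf f(\theta))$ denote the continuous eigenvalue functions of the Hermitian matrix-valued function $\mathbf f$. *)

theory Defs
  imports Complex_Main
    "Jordan_Normal_Form.Char_Poly"
    "Jordan_Normal_Form.Schur_Decomposition"
    "Jordan_Normal_Form.Gauss_Jordan_Elimination"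
begin

definition matrix_trig_poly :: "nat \<Rightarrow> (real \<Rightarrow> complex mat) \<Rightarrow> bool" where
  "matrix_trig_poly d f \<longleftrightarrow>
    (\<exists>(J :: int set) (c :: int \<Rightarrow> complex mat).
      finite J \<and> (\<forall>j\<in>J. c j \<in> carrier_mat d d) \<and>
      (\<forall>\<theta>. f \<theta> = mat d d (\<lambda>(a, b).
        \<Sum>j\<in>J. c j $$ (a, b) * exp (\<i> * of_int j * of_real \<theta>))))"

definition hermitian_mat :: "nat \<Rightarrow> complex mat \<Rightarrow> bool" where
  "hermitian_mat d A \<longleftrightarrow> A \<in> carrier_mat d d \<and> mat_adjoint A = A"

(* (A *\<^sub>v x) \<bullet>c x is the quadratic form x^H A x; it is real for Hermitian A. *)

definition nonneg_def_mat :: "nat \<Rightarrow> complex mat \<Rightarrow> bool" where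
  "nonneg_def_mat d A \<longleftrightarrow> hermitian_mat d A \<and>
    (\<forall>x\<in>carrier_vec d. Re ((A *\<^sub>v x) \<bullet>c x) \<ge> 0)"

definition pos_def_mat :: "nat \<Rightarrow> complex mat \<Rightarrow> bool" where
  "pos_def_mat d A \<longleftrightarrow> hermitian_mat d A \<and>
    (\<forall>x\<in>carrier_vec d. x \<noteq> 0\<^sub>v d \<longrightarrow> Re ((A *\<^sub>v x) \<bullet>c x) > 0)"

(* lam 1, ..., lam d enumerate continuously in \<theta> the (real) eigenvalues of f \<theta>,
   repeated according to multiplicity. *)
definition eigenvalue_functions ::
    "nat \<Rightarrow> (real \<Rightarrow> complex mat) \<Rightarrow> (nat \<Rightarrow> real \<Rightarrow> real) \<Rightarrow> bool" where
  "eigenvalue_functions d f lam \<longleftrightarrow>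
    (\<forall>j\<in>{1..d}. continuous_on UNIV (lam j)) \<and>
    (\<forall>\<theta>. char_poly (f \<theta>) = (\<Prod>j=1..d. [:- complex_of_real (lam j \<theta>), 1:]))"

definition gram_sum :: "(real \<Rightarrow> complex mat) \<Rightarrow> real \<Rightarrow> complex mat" where
  "gram_sum p \<theta> =
    mat_adjoint (p \<theta>) * p \<theta> + mat_adjoint (p (\<theta> + pi)) * p (\<theta> + pi)"

(* mat_inverse returns None exactly for non-invertible matrices, so s_mat p \<theta> is
   meaningful only where gram_sum p \<theta> is invertible, e.g. positive definite. *)
definition s_mat :: "(real \<Rightarrow> complex mat) \<Rightarrow> real \<Rightarrow> complex mat" where
  "s_mat p \<theta> = p \<theta> * the (mat_inverse (gram_sum p \<theta>)) * mat_adjoint (p \<theta>)"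

end

theory Submission
  imports Defs
begin

text \<open>The vector \<open>q\<close> is an eigenvector of the Gram sum G at \<theta>0: the
  shifted term kills \<open>q\<close>, and the other one multiplies it first by \<open>l1\<close>
  (through p) and then by \<open>l2\<close> (through the adjoint of p), so G q = l1 l2 q. Positive
  definiteness makes G invertible (\<open>pos_def_mat_inverse\<close>), and its inverse scales
  \<open>q\<close> by 1/(l1 l2) (\<open>left_inverse_mult_eigenvector\<close>). In s = p G^(-1) p^H
  the three factors, acting on \<open>q\<close> from right to left, contribute l2, 1/(l1 l2) and l1,
  whose product is 1.\<close>

text \<open>A nonzero kernel vector would make the quadratic form vanish, so the determinant is
  nonzero. The \<open>Some\<close> form is what lets \<open>the\<close> in \<open>s_mat\<close> be
  evaluated.\<close>

lemma pos_def_mat_inverse: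
  assumes "pos_def_mat d A"
  obtains B where "mat_inverse A = Some B" "B \<in> carrier_mat d d" "B * A = 1\<^sub>m d"
proof -
  have A: "A \<in> carrier_mat d d"
    using assms by (simp add: pos_def_mat_def hermitian_mat_def)
  have "det A \<noteq> 0"
  proof
    assume "det A = 0"
    then obtain v where v: "v \<in> carrier_vec d" "v \<noteq> 0\<^sub>v d" and "A *\<^sub>v v = 0\<^sub>v d"
      using det_0_iff_vec_prod_zero[OF A] by auto
    then have "(A *\<^sub>v v) \<bullet>c v = 0"
      by simp
    with assms v show False
      by (auto simp: pos_def_mat_def)
  qed
  then have "mat_inverse A \<noteq> None"
    \<comment> \<open>\<open>None\<close> would mean that \<open>A\<close> is not a unit of the
      matrix ring; the \<open>()\<close> only fills the extension slot of the ring record.\<close>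
    using mat_inverse(1)[OF A, of "()"] det_non_zero_imp_unit[OF A, of "()"] by blast
  then obtain B where "mat_inverse A = Some B"
    by auto
  with mat_inverse(2)[OF A this] show thesis
    by (intro that) auto
qed

lemma matrix_trig_poly_carrier:
  "matrix_trig_poly d p \<Longrightarrow> p \<theta> \<in> carrier_mat d d"
  by (auto simp: matrix_trig_poly_def)

text \<open>Applying \<open>B\<close> to the eigenvalue equation gives v = k (B v), and
  \<open>k\<close> can be divided out.\<close>

lemma left_inverse_mult_eigenvector:
  fixes A :: "'a :: field mat"
  assumes A: "A \<in> carrier_mat n n" and B: "B \<in> carrier_mat n n" and BA: "B * A = 1\<^sub>m n"
    and v: "v \<in> carrier_vec n" and ev: "A *\<^sub>v v = k \<cdot>\<^sub>v v" and k: "k \<noteq> 0"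
  shows "B *\<^sub>v v = inverse k \<cdot>\<^sub>v v"
proof -
  have "v = (B * A) *\<^sub>v v"
    using v by (simp add: BA)
  also have "\<dots> = k \<cdot>\<^sub>v (B *\<^sub>v v)"
    using A B v by (simp add: assoc_mult_mat_vec[OF B A v] ev mult_mat_vec[OF B v])
  finally have "inverse k \<cdot>\<^sub>v v = inverse k \<cdot>\<^sub>v (k \<cdot>\<^sub>v (B *\<^sub>v v))"
    by simp
  then show ?thesis
    using k by (simp add: smult_smult_assoc)
qed

theorem lemma4p3:
  fixes d jbar :: nat
    and f p :: "real \<Rightarrow> complex mat"
    and lam :: "nat \<Rightarrow> real \<Rightarrow> real"
    and \<theta>0 :: real
    and q :: "complex vec"
  assumes "d \<ge> 1"
    and "matrix_trig_poly d f"
    and "\<And>\<theta>. nonneg_def_mat d (f \<theta>)"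
    and "eigenvalue_functions d f lam"
    and "\<theta>0 \<in> {0..<2 * pi}"
    and "jbar \<in> {1..d}"
    and "lam jbar \<theta>0 = 0"
    and "\<And>\<theta> j. \<theta> \<in> {0..<2 * pi} \<Longrightarrow> j \<in> {1..d} \<Longrightarrow> (\<theta>, j) \<noteq> (\<theta>0, jbar) \<Longrightarrow> lam j \<theta> > 0"
    and "eigenvector (f \<theta>0) q 0"
    and "matrix_trig_poly d p"
    and "\<And>\<theta>. \<theta> \<in> {0..<2 * pi} \<Longrightarrow> pos_def_mat d (gram_sum p \<theta>)"
    and "\<exists>l1. l1 \<noteq> 0 \<and> p \<theta>0 *\<^sub>v q = l1 \<cdot>\<^sub>v q"
    and "p (\<theta>0 + pi) *\<^sub>v q = 0\<^sub>v d"
    and "\<exists>l2. l2 \<noteq> 0 \<and> mat_adjoint (p \<theta>0) *\<^sub>v q = l2 \<cdot>\<^sub>v q"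
  shows "s_mat p \<theta>0 *\<^sub>v q = q"
proof -
  obtain l1 l2 where l: "l1 \<noteq> 0" "l2 \<noteq> 0"
    and pq: "p \<theta>0 *\<^sub>v q = l1 \<cdot>\<^sub>v q" and paq: "mat_adjoint (p \<theta>0) *\<^sub>v q = l2 \<cdot>\<^sub>v q"
    using assms(12,14) by blast
  have "f \<theta>0 \<in> carrier_mat d d"
    using assms(3) by (simp add: nonneg_def_mat_def hermitian_mat_def)
  \<comment> \<open>\<open>eigenvector\<close> ties the length of \<open>q\<close> to the row
    dimension of the matrix.\<close>
  then have q: "q \<in> carrier_vec d"
    using assms(9) by (simp add: eigenvector_def)
  note P = matrix_trig_poly_carrier[OF assms(10)]
  have Pa: "mat_adjoint (p \<theta>) \<in> carrier_mat d d" for \<theta>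
    using P[of \<theta>] by (auto simp: mat_adjoint_def)
  have pos: "pos_def_mat d (gram_sum p \<theta>0)"
    using assms(11)[OF assms(5)] .
  then obtain B where inv: "mat_inverse (gram_sum p \<theta>0) = Some B"
    and B: "B \<in> carrier_mat d d" and BG: "B * gram_sum p \<theta>0 = 1\<^sub>m d"
    by (rule pos_def_mat_inverse)
  have G: "gram_sum p \<theta>0 \<in> carrier_mat d d"
    using pos by (simp add: pos_def_mat_def hermitian_mat_def)
  have "gram_sum p \<theta>0 *\<^sub>v q =
      mat_adjoint (p \<theta>0) *\<^sub>v (p \<theta>0 *\<^sub>v q) + mat_adjoint (p (\<theta>0 + pi)) *\<^sub>v (p (\<theta>0 + pi) *\<^sub>v q)"
    unfolding gram_sum_def
    by (subst add_mult_distrib_mat_vec[of _ d d])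
      (use P Pa q in \<open>auto simp: assoc_mult_mat_vec[OF Pa P q] intro: mult_carrier_mat[OF Pa P]\<close>)
  \<comment> \<open>The shifted summand is a matrix applied to the zero vector; \<open>l1\<close> is
    pulled out before the adjoint yields \<open>l2\<close>.\<close>
  also have "\<dots> = (l1 * l2) \<cdot>\<^sub>v q"
    using q Pa[of "\<theta>0 + pi"]
    by (auto simp: pq assms(13) mult_mat_vec[OF Pa q] paq smult_smult_assoc)
  finally have "B *\<^sub>v q = inverse (l1 * l2) \<cdot>\<^sub>v q"
    using left_inverse_mult_eigenvector[OF G B BG q] l by simp
  \<comment> \<open>Reassociation lets the three factors act on \<open>q\<close> one at a time, each
    just by a scalar.\<close>
  moreover have "s_mat p \<theta>0 *\<^sub>v q = p \<theta>0 *\<^sub>v (B *\<^sub>v (mat_adjoint (p \<theta>0) *\<^sub>v q))"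
    using B Pa q
    by (simp add: s_mat_def inv assoc_mult_mat_vec[OF mult_carrier_mat[OF P B] Pa q]
        assoc_mult_mat_vec[OF P B mult_mat_vec_carrier[OF Pa q]])
  ultimately show ?thesis
    using l q
    by (simp add: paq pq mult_mat_vec[OF B q] mult_mat_vec[OF P q] smult_smult_assoc field_simps)
qed

end
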